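(* Let $p=(p_i)_{i\in\mathbb{N}}$ and $p'=(p_i')_{i\in\mathbb{N}}$ in $\ell^1$ be given infinite sequences of positive real numbers, let $\mathcal{A}\subset\ell^1$ be the set of all area attainable sequences corresponding to $p$ and $p'$, let $O$ be the zero sequence, and set $$\Delta_i=(p_{i-1}+p_i+p_{i+1})p_{i-1}'p_{i+1}'p_i-(p_{i-1}'+p_i'+p_{i+1}')p_{i-1}p_{i+1}p_i',\qquad i\ge 2.$$ a) If at least one of the numbers $\Delta_i$ is different from $0$, then $\mathcal{A}$ is the union of two nonintersecting open trihedral angles in the same $3$-dimensional vector subspace of $\ell^1$ with common vertex $O$ and a common face, and an open ray with origin $O$ lying on this face and different from its edges. b) If all numbers $\Delta_i$ are equal to $0$, then $\mathcal{A}$ is an open ($2$-dimensional) angle in $\ell^1$ with vertex $O$.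
   Context: $\mathbb{N}=\{1,2,\dots\}$, and $\ell^1$ is the space of real sequences $r=(r_i)_{i\in\mathbb{N}}$ with $\sum_{i=1}^\infty|r_i|<\infty$. Given sequences $p,p'$ of positive real numbers, an infinite sequence $x=(x_i)_{i\in\mathbb{N}}$ of real numbers is called area attainable if there is a convex quadrilateral $ABCD$ in the plane and points $A_0=A,A_1,A_2,\dots$ on side $AB$ and $D_0=D,D_1,D_2,\dots$ on side $DC$ (consecutive along the sides, starting from $A$ and from $D$ respectively) such that $A_0A_1:A_1A_2:\dots=p_1:p_2:\dots$, $D_0D_1:D_1D_2:\dots=p_1':p_2':\dots$ and $x_i=[A_{i-1}A_iD_iD_{i-1}]$ for all $i\in\mathbb{N}$, where $[\cdot]$ denotes area. An open ray with origin $O$ is a set $\{tv:t>0\}$, $v\neq 0$. An open angle with vertex $O$ is a set $\{au+bv:a,b>0\}$ with $u,v$ linearly independent; its arms (edges) are the open rays spanned by $u$ and $v$. An open trihedral angle with vertex $O$ is a set $\{au+bv+cw:a,b,c>0\}$ with $u,v,w$ linearly independent; its edges are the rays spanned by $u,v,w$, and its faces are the plane angles spanned by pairs of its edges.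
   Formalization: Lengths on AB and DC share one factor k: |A_{i-1}A_i| = k p_i, |D_{i-1}D_i| = k p_i'. With independent factors, as the ratio chains literally allow, trapezoids attain every a p + b p' (a,b>0), so a) would give the whole open face instead of a ray and be false. *)

theory Defs
  imports "HOL-Analysis.Analysis" "HOL-Library.Function_Algebras"
begin

text \<open>
  Sequences indexed by 1, 2, ... are functions on \<open>nat\<close>, the value at \<open>n\<close> being the term with
  index \<open>n + 1\<close>. With pointwise operations they form a real vector space, of which \<open>ell1\<close> is a
  subspace.
\<close>

instantiation "fun" :: (type, real_vector) real_vector
begin

definition scaleR_fun_def: "c *\<^sub>R f = (\<lambda>x. c *\<^sub>R f x)"

instance
  by standard (simp_all add: scaleR_fun_def fun_eq_iff algebra_simps)

end

lemma scaleR_fun_apply [simp]: "(c *\<^sub>R f) x = c *\<^sub>R f x"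
  by (simp add: scaleR_fun_def)

definition ell1 :: "(nat \<Rightarrow> real) set" where
  "ell1 = {r. summable (\<lambda>i. \<bar>r i\<bar>)}"

definition open_ray :: "'a::real_vector \<Rightarrow> 'a set" where
  "open_ray v = {t *\<^sub>R v | t. t > 0}"

definition open_angle :: "'a::real_vector \<Rightarrow> 'a \<Rightarrow> 'a set" where
  "open_angle u v = {a *\<^sub>R u + b *\<^sub>R v | a b. a > 0 \<and> b > 0}"

definition open_trihedral :: "'a::real_vector \<Rightarrow> 'a \<Rightarrow> 'a \<Rightarrow> 'a set" where
  "open_trihedral u v w =
    {a *\<^sub>R u + b *\<^sub>R v + c *\<^sub>R w | a b c. a > 0 \<and> b > 0 \<and> c > 0}"

text \<open>A face of a trihedral angle contains its two edges and the vertex.\<close>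

definition face :: "'a::real_vector \<Rightarrow> 'a \<Rightarrow> 'a set" where
  "face u v = {a *\<^sub>R u + b *\<^sub>R v | a b. a \<ge> 0 \<and> b \<ge> 0}"

text \<open>
  \<open>A B C D\<close> are, in this cyclic order, the vertices of a nondegenerate convex quadrilateral iff the
  diagonals meet in an interior point of both. If three of the vertices were collinear, the common
  point of the diagonals would force all four to be collinear.
\<close>

definition convex_quadrilateral ::
    "real^2 \<Rightarrow> real^2 \<Rightarrow> real^2 \<Rightarrow> real^2 \<Rightarrow> bool" where
  "convex_quadrilateral A B C D \<longleftrightarrow>
    \<not> collinear {A, B, C, D} \<and> open_segment A C \<inter> open_segment B D \<noteq> {}"

text \<open>Used only for convex quadrilaterals, whose region is the convex hull of the vertices.\<close>

definition quad_area :: "real^2 \<Rightarrow> real^2 \<Rightarrow> real^2 \<Rightarrow> real^2 \<Rightarrow> real" where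
  "quad_area A B C D = measure lebesgue (convex hull {A, B, C, D})"

definition consecutive_on_side :: "real^2 \<Rightarrow> real^2 \<Rightarrow> (nat \<Rightarrow> real^2) \<Rightarrow> bool" where
  "consecutive_on_side X Y P \<longleftrightarrow>
    P 0 = X \<and> (\<forall>n. P n \<in> closed_segment X Y) \<and>
    (\<forall>n. P n \<in> closed_segment X (P (Suc n)))"

text \<open>
  The two chains of ratios \<open>p\<close> and \<open>p'\<close> are taken with respect to one unit of length: the factor
  \<open>k\<close> is the same on both sides of the quadrilateral. This matters only if \<open>A B\<close> and \<open>D C\<close> are
  parallel, because otherwise an area-preserving affine map equalises the factors. With independent factors,
  trapezoids would contribute \<open>open_angle p p'\<close> and not just \<open>open_ray (p + p')\<close>, so that for
  linearly independent \<open>p\<close>, \<open>p'\<close> the sequences attained by parallel sides would not form a ray.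
\<close>

definition area_attainable ::
    "(nat \<Rightarrow> real) \<Rightarrow> (nat \<Rightarrow> real) \<Rightarrow> (nat \<Rightarrow> real) \<Rightarrow> bool" where
  "area_attainable p p' x \<longleftrightarrow>
    (\<exists>A B C D P Q k.
      convex_quadrilateral A B C D \<and>
      consecutive_on_side A B P \<and> consecutive_on_side D C Q \<and>
      k > 0 \<and>
      (\<forall>n. dist (P n) (P (Suc n)) = k * p n) \<and>
      (\<forall>n. dist (Q n) (Q (Suc n)) = k * p' n) \<and>
      (\<forall>n. x n = quad_area (P n) (P (Suc n)) (Q (Suc n)) (Q n)))"

definition attainable_set :: "(nat \<Rightarrow> real) \<Rightarrow> (nat \<Rightarrow> real) \<Rightarrow> (nat \<Rightarrow> real) set" where
  "attainable_set p p' = {x. area_attainable p p' x}"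

text \<open>Centred at the function argument \<open>i + 1\<close>, i.e. at the term with index \<open>i + 2\<close>.\<close>

definition Delta :: "(nat \<Rightarrow> real) \<Rightarrow> (nat \<Rightarrow> real) \<Rightarrow> nat \<Rightarrow> real" where
  "Delta p p' i =
    (p i + p (i + 1) + p (i + 2)) * p' i * p' (i + 2) * p (i + 1) -
    (p' i + p' (i + 1) + p' (i + 2)) * p i * p (i + 2) * p' (i + 1)"

end

theory Submission
  imports Defs
begin

text \<open>
  Let \<open>\<alpha>\<close>, \<open>\<beta>\<close> be the direction vectors of the sides \<open>A B\<close> and \<open>D C\<close>, scaled by the common factor of the
  two chains of ratios, and \<open>\<delta> = D - A\<close>. With \<open>s n\<close>, \<open>s' n\<close> the partial sums of \<open>p\<close>, \<open>p'\<close>, the points on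
  the sides are \<open>A + s n *\<^sub>R \<alpha>\<close> and \<open>D + s' n *\<^sub>R \<beta>\<close>. The area of a convex quadrilateral is half the wedge
  of its diagonals (\<open>quad_area_wedge\<close>), and for the strips this gives \<open>x = a p + b p' + c q\<close>, where \<open>a\<close>,
  \<open>b\<close>, \<open>c\<close> are half the wedges of \<open>\<alpha>\<close> and \<open>\<delta>\<close>, \<open>\<beta>\<close> and \<open>\<delta>\<close>, \<open>\<alpha>\<close> and \<open>\<beta>\<close>, and \<open>q n\<close> is the increment of
  \<open>s n * s' n\<close>. Convexity amounts to \<open>a, b > 0\<close>, \<open>a + S' c > 0\<close> and \<open>b + S c > 0\<close>, with \<open>S\<close>, \<open>S'\<close> the sums of
  the series. All such triples occur, except that \<open>c = 0\<close> means \<open>\<alpha> = \<beta>\<close> and therefore \<open>a = b\<close>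
  (\<open>area_attainable_iff\<close>). Splitting by the sign of \<open>c\<close> yields the trihedral angles with edges
  \<open>p\<close>, \<open>p'\<close>, \<open>q\<close> and \<open>p\<close>, \<open>p'\<close>, \<open>w = S' p + S p' - q\<close>, and the ray of \<open>p + p'\<close> (\<open>split_by_sign\<close>).

  It remains to decide when \<open>p\<close>, \<open>p'\<close>, \<open>q\<close> are linearly independent. Up to sign, \<open>Delta p p' n\<close> is the
  determinant of the rows \<open>n\<close>, \<open>n + 1\<close>, \<open>n + 2\<close> of these three sequences (\<open>Delta_determinant\<close>), so a single
  nonzero value gives independence and the first case. If all vanish, the linear relation
  that the first two rows satisfy holds in every row, and it has the form \<open>x p - y p' = z q\<close> with \<open>x, y > 0\<close>
  (\<open>relation_if_Delta_zero\<close>). Summing it over all indices yields \<open>x S - y S' = z S S'\<close>, and this makes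
  \<open>p\<close> and \<open>p'\<close> positive combinations of \<open>q\<close> and \<open>w\<close>. The pieces now overlap in a plane,
  and their union is the angle between \<open>q\<close> and \<open>w\<close> (\<open>flat_union_eq_angle\<close>).
\<close>

section \<open>Convexity and area of plane quadrilaterals\<close>

text \<open>
  Twice the signed area of the triangle spanned by the two vectors.
\<close>

definition wedge :: "real^2 \<Rightarrow> real^2 \<Rightarrow> real" where
  "wedge u v = u $ 1 * v $ 2 - u $ 2 * v $ 1"

lemma wedge_scaleR [simp]:
  "wedge (c *\<^sub>R u) v = c * wedge u v" "wedge u (c *\<^sub>R v) = c * wedge u v"
  by (simp_all add: wedge_def algebra_simps)

lemma wedge_add:
  "wedge (u + u') v = wedge u v + wedge u' v" "wedge u (v + v') = wedge u v + wedge u v'"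
  by (simp_all add: wedge_def algebra_simps)

lemma wedge_diff:
  "wedge (u - u') v = wedge u v - wedge u' v" "wedge u (v - v') = wedge u v - wedge u v'"
  by (simp_all add: wedge_def algebra_simps)

lemma wedge_self [simp]: "wedge u u = 0"
  by (simp add: wedge_def)

lemma wedge_commute: "wedge u v = - wedge v u"
  by (simp add: wedge_def)

lemma wedge_eq_0_imp_parallel:
  assumes "wedge u v = 0" and "u \<noteq> 0"
  obtains c where "v = c *\<^sub>R u"
proof -
  have "u $ 1 \<noteq> 0 \<or> u $ 2 \<noteq> 0"
    using assms(2) by (auto simp: vec_eq_iff forall_2)
  then have "v = (if u $ 1 \<noteq> 0 then v $ 1 / u $ 1 else v $ 2 / u $ 2) *\<^sub>R u"
    using assms(1) by (auto simp: wedge_def vec_eq_iff forall_2 field_simps)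
  then show ?thesis by (rule that)
qed

lemma collinear_imp_wedge_eq_0:
  assumes "collinear S" and "x \<in> S" "y \<in> S" "z \<in> S"
  shows "wedge (y - x) (z - x) = 0"
proof -
  obtain u where u: "\<And>x y. x \<in> S \<Longrightarrow> y \<in> S \<Longrightarrow> \<exists>c. x - y = c *\<^sub>R u"
    using assms(1) unfolding collinear_def by blast
  obtain c d where "y - x = c *\<^sub>R u" "z - x = d *\<^sub>R u"
    using u assms by meson
  then show ?thesis by simp
qed

lemma content_triangle_wedge:
  "measure lebesgue (convex hull {A, B, C}) = \<bar>wedge (B - A) (C - A)\<bar> / 2"
proof -
  have "convex hull {A, B, C} \<in> sets borel"
    by (intro borel_closed compact_imp_closed compact_convex_hull finite_imp_compact) simp
  then have "measure lebesgue (convex hull {A, B, C}) = measure lborel (convex hull {A, B, C})"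
    by (simp add: measure_completion)
  then show ?thesis
    by (simp add: content_triangle wedge_def abs_minus_commute mult.commute)
qed

text \<open>
  The two expressions for the crossing point \<open>X\<close> of the diagonals give an affine relation in which
  \<open>A\<close>, \<open>C\<close> occur with one sign and \<open>B\<close>, \<open>D\<close> with the other. Adding a multiple of it to a convex
  combination of the four corners shifts weight from \<open>B\<close>, \<open>D\<close> to \<open>A\<close>, \<open>C\<close>, until \<open>B\<close> or \<open>D\<close>, whichever
  is exhausted first, has weight 0.
\<close>

lemma convex_hull_quadrilateral_split:
  fixes A B C D :: "'a::real_vector"
  assumes "X \<in> open_segment A C" and "X \<in> open_segment B D"
  shows "convex hull {A, B, C, D} = convex hull {A, B, C} \<union> convex hull {A, C, D}"
proof
  obtain s where s: "X = (1 - s) *\<^sub>R A + s *\<^sub>R C" "0 < s" "s < 1"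
    using assms(1) by (auto simp: in_segment)
  obtain t where t: "X = (1 - t) *\<^sub>R B + t *\<^sub>R D" "0 < t" "t < 1"
    using assms(2) by (auto simp: in_segment)
  have X0: "(1 - s) *\<^sub>R A + s *\<^sub>R C = (1 - t) *\<^sub>R B + t *\<^sub>R D"
    using s t by simp
  show "convex hull {A, B, C, D} \<subseteq> convex hull {A, B, C} \<union> convex hull {A, C, D}"
  proof
    fix y assume "y \<in> convex hull {A, B, C, D}"
    then obtain a m z where z: "z \<in> convex hull {B, C, D}" "y = a *\<^sub>R A + m *\<^sub>R z"
      "0 \<le> a" "0 \<le> m" "a + m = 1"
      by (auto simp: convex_hull_insert[of "{B, C, D}" A])
    then obtain b c d where bcd: "z = b *\<^sub>R B + c *\<^sub>R C + d *\<^sub>R D"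
      "0 \<le> b" "0 \<le> c" "0 \<le> d" "b + c + d = 1"
      unfolding convex_hull_3 by blast
    define b' c' d' where "b' = m * b" and "c' = m * c" and "d' = m * d"
    have "a + b' + c' + d' = a + m * (b + c + d)"
      by (simp add: b'_def c'_def d'_def algebra_simps)
    then have "a + b' + c' + d' = 1"
      using z bcd by simp
    moreover have "y = a *\<^sub>R A + b' *\<^sub>R B + c' *\<^sub>R C + d' *\<^sub>R D"
      using z bcd by (simp add: b'_def c'_def d'_def algebra_simps)
    moreover have "0 \<le> b'" "0 \<le> c'" "0 \<le> d'"
      using z bcd by (simp_all add: b'_def c'_def d'_def)
    ultimately obtain b c d where y: "y = a *\<^sub>R A + b *\<^sub>R B + c *\<^sub>R C + d *\<^sub>R D"
      and pos: "0 \<le> a" "0 \<le> b" "0 \<le> c" "0 \<le> d" and sum: "a + b + c + d = 1"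
      using z(3) that by blast
    show "y \<in> convex hull {A, B, C} \<union> convex hull {A, C, D}"
    proof (cases "d / t \<le> b / (1 - t)")
      case True
      define m where "m = d / t"
      have "y = y + m *\<^sub>R ((1 - s) *\<^sub>R A + s *\<^sub>R C - ((1 - t) *\<^sub>R B + t *\<^sub>R D))"
        by (simp add: X0)
      also have "\<dots> = (a + m * (1 - s)) *\<^sub>R A + (b - m * (1 - t)) *\<^sub>R B + (c + m * s) *\<^sub>R C + (d - m * t) *\<^sub>R D"
        by (simp add: y algebra_simps)
      finally have "y = (a + m * (1 - s)) *\<^sub>R A + (b - m * (1 - t)) *\<^sub>R B + (c + m * s) *\<^sub>R C"
        using t by (simp add: m_def)
      moreover have "0 \<le> m" "m * (1 - t) \<le> b" "m * t = d"
        using True t pos by (auto simp: m_def field_simps)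
      moreover from this have "(a + m * (1 - s)) + (b - m * (1 - t)) + (c + m * s) = 1"
        using sum by (simp add: algebra_simps)
      ultimately have "y \<in> convex hull {A, B, C}"
        using pos s unfolding convex_hull_3
        by (intro CollectI exI[of _ "a + m * (1 - s)"] exI[of _ "b - m * (1 - t)"] exI[of _ "c + m * s"]) auto
      then show ?thesis ..
    next
      case False
      define m where "m = b / (1 - t)"
      have "y = y + m *\<^sub>R ((1 - s) *\<^sub>R A + s *\<^sub>R C - ((1 - t) *\<^sub>R B + t *\<^sub>R D))"
        by (simp add: X0)
      also have "\<dots> = (a + m * (1 - s)) *\<^sub>R A + (b - m * (1 - t)) *\<^sub>R B + (c + m * s) *\<^sub>R C + (d - m * t) *\<^sub>R D"
        by (simp add: y algebra_simps)
      finally have "y = (a + m * (1 - s)) *\<^sub>R A + (c + m * s) *\<^sub>R C + (d - m * t) *\<^sub>R D"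
        using t by (simp add: m_def)
      moreover have "0 \<le> m" "m * t \<le> d" "m * (1 - t) = b"
        using False t pos by (auto simp: m_def field_simps)
      moreover from this have "(a + m * (1 - s)) + (c + m * s) + (d - m * t) = 1"
        using sum by (simp add: algebra_simps)
      ultimately have "y \<in> convex hull {A, C, D}"
        using pos s unfolding convex_hull_3
        by (intro CollectI exI[of _ "a + m * (1 - s)"] exI[of _ "c + m * s"] exI[of _ "d - m * t"]) auto
      then show ?thesis ..
    qed
  qed
  show "convex hull {A, B, C} \<union> convex hull {A, C, D} \<subseteq> convex hull {A, B, C, D}"
    by (intro Un_least hull_mono) auto
qed

text \<open>
  The linear functional that vanishes on the line \<open>A C\<close> has on the whole triangle the sign that it
  has at \<open>B\<close>; the two halves of a convex quadrilateral are separated by it.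
\<close>

lemma wedge_sign_on_triangle:
  assumes "y \<in> convex hull {A, B, C}"
  obtains r where "0 \<le> r" and "wedge (C - A) (y - A) = r * wedge (C - A) (B - A)"
proof -
  obtain a b c where y: "y = a *\<^sub>R A + b *\<^sub>R B + c *\<^sub>R C" "0 \<le> b" "a + b + c = 1"
    using assms unfolding convex_hull_3 by blast
  then have a: "a = 1 - b - c" by simp
  have "y - A = b *\<^sub>R (B - A) + c *\<^sub>R (C - A)"
    by (simp add: y a algebra_simps)
  then have "wedge (C - A) (y - A) = b * wedge (C - A) (B - A)"
    by (simp add: wedge_add)
  with y(2) show ?thesis by (rule that)
qed

lemma negligible_line:
  assumes "v \<noteq> (0 :: real^2)"
  shows "negligible {y. wedge v (y - A) = 0}"
proof -
  define n :: "real^2" where "n = (\<chi> i. if i = 1 then - v $ 2 else v $ 1)"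
  have n1: "n $ 1 = - v $ 2" and n2: "n $ 2 = v $ 1"
    by (simp_all add: n_def)
  have "n \<noteq> 0"
    using assms by (auto simp: vec_eq_iff forall_2 n1 n2)
  moreover have "{y. wedge v (y - A) = 0} = {y. n \<bullet> y = n \<bullet> A}"
    by (auto simp: wedge_def inner_vec_def sum_2 n1 n2 algebra_simps)
  ultimately show ?thesis
    using negligible_hyperplane by metis
qed

text \<open>
  A diagonal cuts the quadrilateral into two triangles with \<open>B\<close> and \<open>D\<close> on opposite sides, so that
  their overlap is null and the areas \<open>\<bar>f B\<bar> / 2\<close> and \<open>\<bar>f D\<bar> / 2\<close> add up to \<open>\<bar>f D - f B\<bar> / 2\<close>,
  where \<open>f y = wedge (C - A) (y - A)\<close>.
\<close>

lemma quad_area_diagonals: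
  assumes "X \<in> open_segment A C" and "X \<in> open_segment B D"
  shows "quad_area A B C D = \<bar>wedge (C - A) (D - B)\<bar> / 2"
proof -
  obtain s where s: "X = (1 - s) *\<^sub>R A + s *\<^sub>R C"
    using assms(1) by (auto simp: in_segment)
  obtain t where t: "X = (1 - t) *\<^sub>R B + t *\<^sub>R D" "0 < t" "t < 1"
    using assms(2) by (auto simp: in_segment)
  have "C - A \<noteq> 0"
    using assms(1) by auto
  define f where "f = (\<lambda>y. wedge (C - A) (y - A))"
  have "X - A = s *\<^sub>R (C - A)"
    by (simp add: s algebra_simps)
  moreover have "X - A = (1 - t) *\<^sub>R (B - A) + t *\<^sub>R (D - A)"
    by (simp add: t algebra_simps)
  ultimately have bal: "0 = (1 - t) * f B + t * f D"
    unfolding f_def by (metis wedge_add(2) wedge_scaleR(2) wedge_self mult_zero_right)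
  have opp: "f B * f D \<le> 0"
  proof -
    have "f D = - ((1 - t) / t) * f B"
      using bal t by (simp add: field_simps)
    then have "f B * f D = - ((1 - t) / t) * (f B)\<^sup>2"
      by (simp add: power2_eq_square)
    then show ?thesis using t by (simp add: mult_nonneg_nonneg)
  qed
  have "convex hull {A, B, C} \<inter> convex hull {A, C, D} \<subseteq> {y. f y = 0}"
  proof
    fix y assume y: "y \<in> convex hull {A, B, C} \<inter> convex hull {A, C, D}"
    obtain r where r: "0 \<le> r" "f y = r * f B"
      using y wedge_sign_on_triangle[of y A B C] unfolding f_def by auto
    obtain r' where r': "0 \<le> r'" "f y = r' * f D"
      using y wedge_sign_on_triangle[of y A D C] unfolding f_def by (auto simp: insert_commute)
    have "(f y)\<^sup>2 = (r * r') * (f B * f D)"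
      using r r' by (simp add: power2_eq_square)
    also have "\<dots> \<le> 0"
      using r r' opp by (simp add: mult_nonneg_nonpos)
    finally show "y \<in> {y. f y = 0}" by simp
  qed
  then have neg: "negligible (convex hull {A, B, C} \<inter> convex hull {A, C, D})"
    using negligible_line[OF \<open>C - A \<noteq> 0\<close>] negligible_subset unfolding f_def by blast
  have meas: "convex hull {A, B, C} \<in> lmeasurable" "convex hull {A, C, D} \<in> lmeasurable"
    by (auto intro!: lmeasurable_compact finite_imp_compact_convex_hull)
  have "quad_area A B C D =
      measure lebesgue (convex hull {A, B, C}) + measure lebesgue (convex hull {A, C, D})"
    unfolding quad_area_def
    using measure_Un3_negligible[OF meas, of "{}"] neg
      convex_hull_quadrilateral_split[OF assms] by simp
  also have "\<dots> = \<bar>f B\<bar> / 2 + \<bar>f D\<bar> / 2"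
    unfolding content_triangle_wedge f_def by (subst wedge_commute[of "B - A"]) simp
  also have "\<dots> = \<bar>f D - f B\<bar> / 2"
    using opp by (auto simp: abs_if mult_less_0_iff mult_le_0_iff)
  also have "f D - f B = wedge (C - A) (D - B)"
    by (simp add: f_def wedge_diff)
  finally show ?thesis .
qed

text \<open>
  Convexity means that the four corners turn in the same direction; \<open>\<sigma>\<close> is the orientation. With
  \<open>k\<close> the wedge of the diagonals, the wedges at the corners are \<open>s * k\<close>, \<open>t * k\<close>, \<open>(1 - s) * k\<close> and
  \<open>(1 - t) * k\<close>, where \<open>s\<close> and \<open>t\<close> are the positions of the crossing point on the diagonals: all
  have the sign of \<open>k\<close> if the diagonals cross, and conversely \<open>s\<close>, \<open>t\<close> can be read off from them.
\<close>

lemma convex_quadrilateral_iff_wedge: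
  "convex_quadrilateral A (A + u) (A + w + v) (A + w) \<longleftrightarrow>
     (\<exists>\<sigma> \<in> {1, -1}. \<sigma> * wedge u w > 0 \<and> \<sigma> * wedge v w > 0 \<and>
        \<sigma> * (wedge u w + wedge u v) > 0 \<and> \<sigma> * (wedge v w + wedge u v) > 0)"
  (is "?L \<longleftrightarrow> ?R")
proof
  assume ?L
  then obtain X where X: "X \<in> open_segment A (A + w + v)" "X \<in> open_segment (A + u) (A + w)"
    and ncol: "\<not> collinear {A, A + u, A + w + v, A + w}"
    unfolding convex_quadrilateral_def by auto
  obtain s where s: "X = (1 - s) *\<^sub>R A + s *\<^sub>R (A + w + v)" "0 < s" "s < 1"
    using X by (auto simp: in_segment)
  obtain t where t: "X = (1 - t) *\<^sub>R (A + u) + t *\<^sub>R (A + w)" "0 < t" "t < 1"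
    using X by (auto simp: in_segment)
  have nz: "w + v \<noteq> 0"
    using X(1) by (metis add.assoc add.right_neutral open_segment_idem empty_iff)
  have eq: "s *\<^sub>R (w + v) = u + t *\<^sub>R (w - u)"
    using s(1) t(1) by (simp add: algebra_simps)
  define k where "k = wedge u w + wedge v w + wedge u v"
  have kw: "k = wedge (w + v) (w - u)"
    by (simp add: k_def wedge_def algebra_simps)
  have 1: "wedge u w = s * k"
    using arg_cong[OF eq, of "\<lambda>x. wedge x (w - u)"] unfolding kw
    by (simp add: wedge_def algebra_simps)
  have 2: "wedge u w + wedge u v = t * k"
    using arg_cong[OF eq, of "\<lambda>x. wedge x (w + v)"] unfolding kw
    by (simp add: wedge_def algebra_simps)
  have 3: "wedge v w = (1 - t) * k" "wedge v w + wedge u v = (1 - s) * k"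
    using 1 2 by (simp_all add: k_def algebra_simps)
  \<comment> \<open>parallel diagonals that cross would put all four corners on one line\<close>
  have "k \<noteq> 0"
  proof
    assume "k = 0"
    then obtain c where c: "w - u = c *\<^sub>R (w + v)"
      using nz kw by (metis wedge_eq_0_imp_parallel)
    have u: "u = (s - t * c) *\<^sub>R (w + v)"
      using eq c by (simp add: algebra_simps)
    moreover have "w = (s - t * c + c) *\<^sub>R (w + v)"
      using c u by (simp add: algebra_simps)
    ultimately have "{A, A + u, A + w + v, A + w} \<subseteq> (\<lambda>r. A + r *\<^sub>R (w + v)) ` UNIV"
      by (auto simp: image_iff) (metis add.assoc scaleR_one)+
    moreover have "collinear ((\<lambda>r. A + r *\<^sub>R (w + v)) ` UNIV)"
      unfolding collinear_def
      by (intro exI[of _ "w + v"]) (auto simp flip: scaleR_diff_left)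
    ultimately show False
      using ncol collinear_subset by blast
  qed
  then have "sgn k \<in> {1, -1}" "sgn k * k > 0"
    by (auto simp: sgn_if)
  moreover have "sgn k * (r * k) > 0" if "r > 0" for r
    using that \<open>sgn k * k > 0\<close> by (simp add: mult.left_commute)
  ultimately show ?R
    using s t unfolding 2 3(2) unfolding 1 3(1) by (intro bexI[of _ "sgn k"]) auto
next
  assume ?R
  then obtain \<sigma> where \<sigma>: "\<sigma> = 1 \<or> \<sigma> = -1"
    and pos: "\<sigma> * wedge u w > 0" "\<sigma> * wedge v w > 0"
       "\<sigma> * (wedge u w + wedge u v) > 0" "\<sigma> * (wedge v w + wedge u v) > 0" by blast
  define k where "k = wedge u w + wedge v w + wedge u v"
  define s where "s = wedge u w / k"
  define t where "t = (wedge u w + wedge u v) / k"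
  have k: "k \<noteq> 0"
    using \<sigma> pos by (auto simp: k_def)
  have s: "0 < s" "s < 1" and t: "0 < t" "t < 1"
    using \<sigma> pos by (auto simp: s_def t_def k_def field_simps)
  have "k *\<^sub>R (s *\<^sub>R (w + v)) = k *\<^sub>R (u + t *\<^sub>R (w - u))"
    using k by (simp add: s_def t_def scaleR_add_right)
      (simp add: k_def wedge_def vec_eq_iff forall_2 algebra_simps)
  then have eq: "s *\<^sub>R (w + v) = u + t *\<^sub>R (w - u)"
    using k scaleR_left_imp_eq by blast
  define X where "X = A + s *\<^sub>R (w + v)"
  have ne: "A \<noteq> A + w + v"
  proof
    assume "A = A + w + v"
    then have "v = - w" by (simp add: add.assoc eq_neg_iff_add_eq_0 add.commute)
    then show False using pos by (simp add: wedge_def)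
  qed
  have ne': "A + u \<noteq> A + w"
    using pos by (auto simp: wedge_def)
  have "X \<in> open_segment A (A + w + v)"
    unfolding in_segment using ne s by (intro conjI exI[of _ s]) (auto simp: X_def algebra_simps)
  moreover have "X \<in> open_segment (A + u) (A + w)"
    unfolding in_segment using ne' t eq by (intro conjI exI[of _ t]) (auto simp: X_def algebra_simps)
  moreover have "\<not> collinear {A, A + u, A + w + v, A + w}"
    using collinear_imp_wedge_eq_0[of _ A "A + u" "A + w"] pos by fastforce
  ultimately show ?L
    unfolding convex_quadrilateral_def by blast
qed

lemma quad_area_wedge:
  assumes "convex_quadrilateral A (A + u) (A + w + v) (A + w)"
  shows "quad_area A (A + u) (A + w + v) (A + w) = \<bar>wedge u w + wedge v w + wedge u v\<bar> / 2"
proof -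
  obtain X where X: "X \<in> open_segment A (A + w + v)" "X \<in> open_segment (A + u) (A + w)"
    using assms unfolding convex_quadrilateral_def by auto
  show ?thesis
    unfolding quad_area_diagonals[OF X] by (simp add: wedge_def algebra_simps)
qed

section \<open>Sequences of strip areas\<close>

text \<open>
  An affine function that is positive at the ends of an interval is positive on it; this passes
  convexity of a quadrilateral on to the strips cut out of it.
\<close>

lemma affine_pos_between:
  fixes a c :: real
  assumes "0 < a" "0 < a + T * c" "0 \<le> s" "s \<le> T"
  shows "0 < a + s * c"
proof (cases "c \<ge> 0")
  case True
  then show ?thesis using assms by (simp add: add_pos_nonneg)
next
  case False
  then have "T * c \<le> s * c"
    using assms by (simp add: mult_right_mono_neg)
  then show ?thesis using assms by linarith
qed

lemma convex_quadrilateral_strip: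
  assumes "T > 0" "T' > 0"
  shows "convex_quadrilateral A (A + T *\<^sub>R \<alpha>) (A + \<delta> + T' *\<^sub>R \<beta>) (A + \<delta>) \<longleftrightarrow>
    (\<exists>\<sigma> \<in> {1, -1}. \<sigma> * wedge \<alpha> \<delta> > 0 \<and> \<sigma> * wedge \<beta> \<delta> > 0 \<and>
      \<sigma> * wedge \<alpha> \<delta> + T' * (\<sigma> * wedge \<alpha> \<beta>) > 0 \<and>
      \<sigma> * wedge \<beta> \<delta> + T * (\<sigma> * wedge \<alpha> \<beta>) > 0)"
proof -
  have *: "\<sigma> * (T * a + T' * (T * c)) = T * (\<sigma> * a + T' * (\<sigma> * c))"
    "\<sigma> * (T' * b + T' * (T * c)) = T' * (\<sigma> * b + T * (\<sigma> * c))" for \<sigma> a b c :: real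
    by (simp_all add: algebra_simps)
  show ?thesis
    unfolding convex_quadrilateral_iff_wedge wedge_scaleR *
    using assms by (simp add: zero_less_mult_iff mult_less_0_iff)
qed

text \<open>
  The strip with corners at positions \<open>s\<close>, \<open>s + r\<close> on one side and \<open>s'\<close>, \<open>s' + r'\<close> on the other is
  a quadrilateral of the same kind with \<open>\<delta> + s' *\<^sub>R \<beta> - s *\<^sub>R \<alpha>\<close> in place of \<open>\<delta>\<close>. The pairing of \<open>\<alpha>\<close> with
  \<open>\<beta>\<close> is multiplied by the increment of the product of the two positions.
\<close>

lemma quad_area_strip:
  fixes \<sigma> :: real
  assumes \<sigma>: "\<sigma> \<in> {1, -1}"
    and pos: "\<sigma> * wedge \<alpha> \<delta> > 0" "\<sigma> * wedge \<beta> \<delta> > 0"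
      "\<sigma> * wedge \<alpha> \<delta> + T' * (\<sigma> * wedge \<alpha> \<beta>) > 0"
      "\<sigma> * wedge \<beta> \<delta> + T * (\<sigma> * wedge \<alpha> \<beta>) > 0"
    and s: "0 \<le> s" "0 < r" "s + r \<le> T"
    and s': "0 \<le> s'" "0 < r'" "s' + r' \<le> T'"
  shows "quad_area (A + s *\<^sub>R \<alpha>) (A + (s + r) *\<^sub>R \<alpha>) (A + \<delta> + (s' + r') *\<^sub>R \<beta>) (A + \<delta> + s' *\<^sub>R \<beta>) =
    (r * (\<sigma> * wedge \<alpha> \<delta>) + r' * (\<sigma> * wedge \<beta> \<delta>) +
      ((s + r) * (s' + r') - s * s') * (\<sigma> * wedge \<alpha> \<beta>)) / 2"
proof -
  define A0 where "A0 = A + s *\<^sub>R \<alpha>"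
  define \<delta>0 where "\<delta>0 = \<delta> + s' *\<^sub>R \<beta> - s *\<^sub>R \<alpha>"
  have corners: "A + (s + r) *\<^sub>R \<alpha> = A0 + r *\<^sub>R \<alpha>"
      "A + \<delta> + s' *\<^sub>R \<beta> = A0 + \<delta>0"
      "A + \<delta> + (s' + r') *\<^sub>R \<beta> = A0 + \<delta>0 + r' *\<^sub>R \<beta>"
    by (simp_all add: A0_def \<delta>0_def algebra_simps)
  have w: "wedge \<alpha> \<delta>0 = wedge \<alpha> \<delta> + s' * wedge \<alpha> \<beta>" "wedge \<beta> \<delta>0 = wedge \<beta> \<delta> + s * wedge \<alpha> \<beta>"
    by (simp_all add: \<delta>0_def wedge_def algebra_simps)
  have p: "0 < \<sigma> * wedge \<alpha> \<delta>0" "0 < \<sigma> * wedge \<beta> \<delta>0"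
    "\<sigma> * wedge \<alpha> \<delta>0 + r' * (\<sigma> * wedge \<alpha> \<beta>) > 0"
    "\<sigma> * wedge \<beta> \<delta>0 + r * (\<sigma> * wedge \<alpha> \<beta>) > 0"
    using affine_pos_between[OF pos(1,3), of s'] affine_pos_between[OF pos(1,3), of "s' + r'"]
      affine_pos_between[OF pos(2,4), of s] affine_pos_between[OF pos(2,4), of "s + r"] s s'
    by (simp_all add: w algebra_simps)
  have conv: "convex_quadrilateral A0 (A0 + r *\<^sub>R \<alpha>) (A0 + \<delta>0 + r' *\<^sub>R \<beta>) (A0 + \<delta>0)"
    unfolding convex_quadrilateral_strip[OF s(2) s'(2)] using \<sigma> p by blast
  define area where "area = r * wedge \<alpha> \<delta>0 + r' * wedge \<beta> \<delta>0 + r * (r' * wedge \<alpha> \<beta>)"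
  have "0 < r * (\<sigma> * wedge \<alpha> \<delta>0 + r' * (\<sigma> * wedge \<alpha> \<beta>)) + r' * (\<sigma> * wedge \<beta> \<delta>0)"
    using mult_pos_pos[OF s(2) p(3)] mult_pos_pos[OF s'(2) p(2)] by linarith
  then have "0 < \<sigma> * area"
    by (simp add: area_def algebra_simps)
  then have "\<bar>area\<bar> = \<sigma> * area"
    using \<sigma> by auto
  moreover have "quad_area A0 (A0 + r *\<^sub>R \<alpha>) (A0 + \<delta>0 + r' *\<^sub>R \<beta>) (A0 + \<delta>0) = \<bar>area\<bar> / 2"
    unfolding quad_area_wedge[OF conv] by (simp add: area_def ac_simps)
  ultimately show ?thesis
    unfolding A0_def[symmetric] corners by (simp add: area_def w algebra_simps)
qed

lemma in_closed_segment_along: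
  fixes \<alpha> :: "'a::real_vector"
  assumes "0 \<le> r" "r \<le> T"
  shows "X + r *\<^sub>R \<alpha> \<in> closed_segment X (X + T *\<^sub>R \<alpha>)"
proof (cases "T = 0")
  case True
  then show ?thesis using assms by simp
next
  case False
  then show ?thesis
    unfolding in_segment using assms
    by (intro exI[of _ "r / T"]) (auto simp: algebra_simps)
qed

lemma consecutive_on_side_along:
  fixes p :: "nat \<Rightarrow> real" and X \<alpha> :: "real^2"
  assumes "summable p" and "\<And>i. p i > 0"
  shows "consecutive_on_side X (X + suminf p *\<^sub>R \<alpha>) (\<lambda>n. X + (\<Sum>i<n. p i) *\<^sub>R \<alpha>)"
proof -
  have "0 \<le> (\<Sum>i<n. p i)" for n
    using assms(2) by (simp add: sum_nonneg less_imp_le)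
  moreover have "(\<Sum>i<n. p i) \<le> suminf p" for n
    using assms by (intro sum_le_suminf) (auto intro: less_imp_le)
  moreover have "(\<Sum>i<n. p i) \<le> (\<Sum>i<Suc n. p i)" for n
    using assms(2)[of n] by simp
  ultimately show ?thesis
    unfolding consecutive_on_side_def
    by (auto simp del: sum.lessThan_Suc intro!: in_closed_segment_along)
qed

text \<open>
  Consecutive points have additive distances from \<open>X\<close>, so the positions are the partial sums of the
  ratios. The far end of the side, at position \<open>T\<close>, may lie beyond the limit of the points.
\<close>

lemma consecutive_on_side_obtain_direction:
  fixes p :: "nat \<Rightarrow> real"
  assumes side: "consecutive_on_side X Y P"
    and dist: "\<And>n. dist (P n) (P (Suc n)) = k * p n"
    and "k > 0" and "summable p" and pos: "\<And>i. p i > 0"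
  obtains \<alpha> T where "norm \<alpha> = k" "suminf p \<le> T" "Y = X + T *\<^sub>R \<alpha>"
    "\<And>n. P n = X + (\<Sum>i<n. p i) *\<^sub>R \<alpha>"
proof -
  have P0: "P 0 = X" and onY: "\<And>n. P n \<in> closed_segment X Y"
    and onS: "\<And>n. P n \<in> closed_segment X (P (Suc n))"
    using side by (auto simp: consecutive_on_side_def)
  have distX: "dist X (P n) = k * (\<Sum>i<n. p i)" for n
  proof (induction n)
    case 0
    then show ?case by (simp add: P0)
  next
    case (Suc n)
    have "dist X (P (Suc n)) = dist X (P n) + dist (P n) (P (Suc n))"
      using onS[of n] by (simp add: between flip: between_mem_segment)
    then show ?case
      using Suc by (simp add: dist algebra_simps)
  qed
  define L where "L = dist X Y"
  have le: "k * (\<Sum>i<n. p i) \<le> L" for n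
    using onY[of n] distX[of n] dist_in_closed_segment(1)[of "P n" X Y]
    by (simp add: L_def dist_commute)
  have "0 < k * (\<Sum>i<1. p i)"
    using \<open>k > 0\<close> pos by simp
  then have "L > 0"
    using le[of 1] by linarith
  define \<alpha> where "\<alpha> = (k / L) *\<^sub>R (Y - X)"
  have "norm \<alpha> = k"
    using \<open>k > 0\<close> \<open>L > 0\<close> by (simp add: \<alpha>_def L_def dist_norm norm_minus_commute)
  moreover have "suminf p \<le> L / k"
    using le \<open>k > 0\<close> by (intro suminf_le_const[OF \<open>summable p\<close>]) (simp add: field_simps)
  moreover have "Y = X + (L / k) *\<^sub>R \<alpha>"
    using \<open>k > 0\<close> \<open>L > 0\<close> by (simp add: \<alpha>_def)
  moreover have "P n = X + (\<Sum>i<n. p i) *\<^sub>R \<alpha>" for n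
  proof -
    obtain u where u: "0 \<le> u" "P n = (1 - u) *\<^sub>R X + u *\<^sub>R Y"
      using onY[of n] by (auto simp: in_segment)
    then have Pn: "P n = X + u *\<^sub>R (Y - X)"
      by (simp add: algebra_simps)
    then have "k * (\<Sum>i<n. p i) = u * L"
      using distX[of n] u(1) by (simp add: L_def dist_norm norm_minus_commute)
    then have "(\<Sum>i<n. p i) * (k / L) = u"
      using \<open>L > 0\<close> by (simp add: field_simps)
    then show ?thesis
      by (simp add: Pn \<alpha>_def)
  qed
  ultimately show ?thesis by (rule that)
qed

text \<open>
  Perpendicular vectors of length \<open>sqrt \<bar>c\<bar>\<close> do it if \<open>c \<noteq> 0\<close>. If \<open>c = 0\<close>, the same vector
  serves as \<open>\<alpha>\<close> and \<open>\<beta>\<close>, which is where \<open>a = b\<close> comes in.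
\<close>

lemma realize_wedges:
  fixes a b c :: real
  assumes "a > 0" "c = 0 \<longrightarrow> a = b"
  obtains \<alpha> \<beta> \<delta> :: "real^2"
  where "norm \<alpha> = norm \<beta>" "\<alpha> \<noteq> 0" "wedge \<alpha> \<delta> = a" "wedge \<beta> \<delta> = b" "wedge \<alpha> \<beta> = c"
proof (cases "c = 0")
  case True
  show ?thesis
    by (rule that[of "vector [1, 0]" "vector [1, 0]" "vector [0, a]"])
      (use True assms in \<open>auto simp: wedge_def vec_eq_iff forall_2\<close>)
next
  case False
  define r where "r = sqrt \<bar>c\<bar>"
  have r: "r > 0" "r * r = \<bar>c\<bar>"
    using False by (auto simp: r_def)
  have "norm (vector [r, 0] :: real^2) = norm (vector [0, sgn c * r] :: real^2)"
    using False by (auto simp: norm_vec_def L2_set_def sum_2 sgn_if)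
  moreover have "r * (sgn c * r) = c"
    using r by (simp add: sgn_if)
  moreover have "sgn c * r * (b * sgn c / r) = b"
    using r False by (auto simp: sgn_if)
  ultimately show ?thesis
    by (intro that[of "vector [r, 0]" "vector [0, sgn c * r]" "vector [- b * sgn c / r, a / r]"])
      (use r in \<open>auto simp: wedge_def vec_eq_iff forall_2\<close>)
qed

definition product_increment :: "(nat \<Rightarrow> real) \<Rightarrow> (nat \<Rightarrow> real) \<Rightarrow> nat \<Rightarrow> real" where
  "product_increment p p' n =
    (\<Sum>i<Suc n. p i) * (\<Sum>i<Suc n. p' i) - (\<Sum>i<n. p i) * (\<Sum>i<n. p' i)"

text \<open>
  The coefficients \<open>a\<close>, \<open>b\<close>, \<open>c\<close> are half the wedges of \<open>\<alpha>\<close> with \<open>\<delta>\<close>, of \<open>\<beta>\<close> with \<open>\<delta>\<close> and of \<open>\<alpha>\<close> with \<open>\<beta>\<close>, up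
  to orientation; the four inequalities express convexity at the corners \<open>A\<close>, \<open>D\<close>, \<open>B\<close>, \<open>C\<close>. Shortening
  the sides to the limits of the points weakens them, so the shortest sides give all values.
\<close>

lemma area_attainable_iff:
  fixes p p' :: "nat \<Rightarrow> real"
  assumes sm: "summable p" "summable p'"
    and pos: "\<And>i. p i > 0" "\<And>i. p' i > 0"
  shows "area_attainable p p' x \<longleftrightarrow>
    (\<exists>a b c. a > 0 \<and> b > 0 \<and> a + suminf p' * c > 0 \<and> b + suminf p * c > 0 \<and> (c = 0 \<longrightarrow> a = b) \<and>
      x = a *\<^sub>R p + b *\<^sub>R p' + c *\<^sub>R product_increment p p')"
  (is "?L \<longleftrightarrow> ?R")
proof -
  have S0: "0 \<le> (\<Sum>i<n. p i)" "0 \<le> (\<Sum>i<n. p' i)" for n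
    using pos by (simp_all add: sum_nonneg less_imp_le)
  have Sle: "(\<Sum>i<n. p i) + p n \<le> suminf p" "(\<Sum>i<n. p' i) + p' n \<le> suminf p'" for n
    using sum_le_suminf[OF sm(1), of "{..<Suc n}"] sum_le_suminf[OF sm(2), of "{..<Suc n}"] pos
    by (auto intro: less_imp_le)
  have Spos: "suminf p > 0" "suminf p' > 0"
    using sm pos by (auto intro: suminf_pos)
  show ?thesis
  proof
    assume ?L
    then obtain A B C D P Q k where conv: "convex_quadrilateral A B C D"
      and sides: "consecutive_on_side A B P" "consecutive_on_side D C Q"
      and k: "k > 0" and dist: "\<And>n. dist (P n) (P (Suc n)) = k * p n"
        "\<And>n. dist (Q n) (Q (Suc n)) = k * p' n"
      and x: "\<And>n. x n = quad_area (P n) (P (Suc n)) (Q (Suc n)) (Q n)"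
      unfolding area_attainable_def by blast
    obtain \<alpha> T where \<alpha>: "norm \<alpha> = k" "suminf p \<le> T" "B = A + T *\<^sub>R \<alpha>"
      "\<And>n. P n = A + (\<Sum>i<n. p i) *\<^sub>R \<alpha>"
      using consecutive_on_side_obtain_direction[OF sides(1) dist(1) k sm(1) pos(1)] by metis
    obtain \<beta> T' where \<beta>: "norm \<beta> = k" "suminf p' \<le> T'" "C = D + T' *\<^sub>R \<beta>"
      "\<And>n. Q n = D + (\<Sum>i<n. p' i) *\<^sub>R \<beta>"
      using consecutive_on_side_obtain_direction[OF sides(2) dist(2) k sm(2) pos(2)] by metis
    define \<delta> where "\<delta> = D - A"
    have D: "D = A + \<delta>"
      by (simp add: \<delta>_def)
    have T: "T > 0" "T' > 0"
      using Spos \<alpha>(2) \<beta>(2) by auto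
    obtain \<sigma> where \<sigma>: "\<sigma> \<in> {1, -1 :: real}"
      and sig: "\<sigma> * wedge \<alpha> \<delta> > 0" "\<sigma> * wedge \<beta> \<delta> > 0"
      "\<sigma> * wedge \<alpha> \<delta> + T' * (\<sigma> * wedge \<alpha> \<beta>) > 0"
      "\<sigma> * wedge \<beta> \<delta> + T * (\<sigma> * wedge \<alpha> \<beta>) > 0"
      using conv unfolding \<alpha>(3) \<beta>(3) D convex_quadrilateral_strip[OF T] by blast
    define a b c where "a = \<sigma> * wedge \<alpha> \<delta> / 2" and "b = \<sigma> * wedge \<beta> \<delta> / 2"
      and "c = \<sigma> * wedge \<alpha> \<beta> / 2"
    have "a > 0" "b > 0"
      using sig(1,2) by (simp_all only: a_def b_def half_gt_zero)
    moreover have "a + suminf p' * c > 0"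
    proof -
      have "a + suminf p' * c = (\<sigma> * wedge \<alpha> \<delta> + suminf p' * (\<sigma> * wedge \<alpha> \<beta>)) / 2"
        by (simp add: a_def c_def add_divide_distrib)
      then show ?thesis
        using affine_pos_between[OF sig(1,3) less_imp_le[OF Spos(2)] \<beta>(2)]
        by (simp only: half_gt_zero)
    qed
    moreover have "b + suminf p * c > 0"
    proof -
      have "b + suminf p * c = (\<sigma> * wedge \<beta> \<delta> + suminf p * (\<sigma> * wedge \<alpha> \<beta>)) / 2"
        by (simp add: b_def c_def add_divide_distrib)
      then show ?thesis
        using affine_pos_between[OF sig(2,4) less_imp_le[OF Spos(1)] \<alpha>(2)]
        by (simp only: half_gt_zero)
    qed
    \<comment> \<open>parallel sides: the common scale \<open>k\<close> makes the direction vectors equal\<close>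
    moreover have "a = b" if "c = 0"
    proof -
      have "\<alpha> \<noteq> 0"
        using \<alpha>(1) k by auto
      moreover have "wedge \<alpha> \<beta> = 0"
        using that \<sigma> by (auto simp: c_def)
      ultimately obtain t where t: "\<beta> = t *\<^sub>R \<alpha>"
        using wedge_eq_0_imp_parallel by blast
      then have "b = t * a"
        by (simp add: a_def b_def)
      then have "t > 0"
        using \<open>a > 0\<close> \<open>b > 0\<close> by (simp add: zero_less_mult_iff)
      then have "t = 1"
        using \<alpha>(1) \<beta>(1) k t by simp
      then show ?thesis
        using \<open>b = t * a\<close> by simp
    qed
    moreover have "x n = a * p n + b * p' n + c * product_increment p p' n" for n
    proof -
      have "x n = (p n * (\<sigma> * wedge \<alpha> \<delta>) + p' n * (\<sigma> * wedge \<beta> \<delta>) +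
        (((\<Sum>i<n. p i) + p n) * ((\<Sum>i<n. p' i) + p' n) - (\<Sum>i<n. p i) * (\<Sum>i<n. p' i)) *
        (\<sigma> * wedge \<alpha> \<beta>)) / 2"
        unfolding x \<alpha>(4) \<beta>(4) D sum.lessThan_Suc
        by (rule quad_area_strip[OF \<sigma> sig S0(1) pos(1) order_trans[OF Sle(1) \<alpha>(2)]
              S0(2) pos(2) order_trans[OF Sle(2) \<beta>(2)]])
      then show ?thesis
        by (simp add: a_def b_def c_def product_increment_def add_divide_distrib ac_simps)
    qed
    ultimately show ?R
      by (intro exI[of _ a] exI[of _ b] exI[of _ c]) (auto simp: fun_eq_iff)
  next
    assume ?R
    then obtain a b c where abc: "a > 0" "b > 0" "a + suminf p' * c > 0" "b + suminf p * c > 0"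
        "c = 0 \<longrightarrow> a = b" and x: "x = a *\<^sub>R p + b *\<^sub>R p' + c *\<^sub>R product_increment p p'"
      by blast
    obtain \<alpha> \<beta> \<delta> :: "real^2" where norms: "norm \<alpha> = norm \<beta>" "\<alpha> \<noteq> 0"
      and w: "wedge \<alpha> \<delta> = 2 * a" "wedge \<beta> \<delta> = 2 * b" "wedge \<alpha> \<beta> = 2 * c"
      using abc realize_wedges[of "2 * a" "2 * c" "2 * b"] by auto
    \<comment> \<open>the quadrilateral has its corner \<open>A\<close> at the origin, sides ending at the limits of the points, and
      orientation 1; the zero summands and unit factors keep the shape of the strip lemmas\<close>
    define P Q where "P = (\<lambda>n. 0 + (\<Sum>i<n. p i) *\<^sub>R \<alpha>)" and "Q = (\<lambda>n. 0 + \<delta> + (\<Sum>i<n. p' i) *\<^sub>R \<beta>)"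
    have sig: "1 * wedge \<alpha> \<delta> > 0" "1 * wedge \<beta> \<delta> > 0"
        "1 * wedge \<alpha> \<delta> + suminf p' * (1 * wedge \<alpha> \<beta>) > 0"
        "1 * wedge \<beta> \<delta> + suminf p * (1 * wedge \<alpha> \<beta>) > 0"
      using abc by (auto simp: w algebra_simps)
    have "convex_quadrilateral 0 (0 + suminf p *\<^sub>R \<alpha>) (0 + \<delta> + suminf p' *\<^sub>R \<beta>) (0 + \<delta>)"
      unfolding convex_quadrilateral_strip[OF Spos] using sig by blast
    moreover have "consecutive_on_side 0 (0 + suminf p *\<^sub>R \<alpha>) P"
      unfolding P_def using sm pos by (intro consecutive_on_side_along)
    moreover have "consecutive_on_side (0 + \<delta>) (0 + \<delta> + suminf p' *\<^sub>R \<beta>) Q"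
      unfolding Q_def using sm pos by (intro consecutive_on_side_along)
    moreover have "dist (P n) (P (Suc n)) = norm \<alpha> * p n" "dist (Q n) (Q (Suc n)) = norm \<alpha> * p' n" for n
      using pos[of n] norms by (auto simp: P_def Q_def dist_norm algebra_simps)
    moreover have "x n = quad_area (P n) (P (Suc n)) (Q (Suc n)) (Q n)" for n
      unfolding P_def Q_def sum.lessThan_Suc
      by (subst quad_area_strip[OF _ sig S0(1) pos(1) Sle(1) S0(2) pos(2) Sle(2)])
        (simp_all add: x w product_increment_def add_divide_distrib ac_simps)
    ultimately show ?L
      unfolding area_attainable_def using norms(2)
      by - (rule exI[of _ "0::real^2"], rule exI[of _ "0 + suminf p *\<^sub>R \<alpha>"],
          rule exI[of _ "0 + \<delta> + suminf p' *\<^sub>R \<beta>"], rule exI[of _ "0 + \<delta>"],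
          rule exI[of _ P], rule exI[of _ Q], rule exI[of _ "norm \<alpha>"], simp only: zero_less_norm_iff simp_thms)
  qed
qed

section \<open>Linear relations between the ratios and their product increments\<close>

lemma product_increment_sums:
  assumes "summable p" "summable p'"
  shows "product_increment p p' sums (suminf p * suminf p')"
proof -
  have "(\<Sum>i<n. product_increment p p' i) = (\<Sum>i<n. p i) * (\<Sum>i<n. p' i)" for n
    unfolding product_increment_def by (induction n) auto
  moreover have "(\<lambda>n. (\<Sum>i<n. p i) * (\<Sum>i<n. p' i)) \<longlonglongrightarrow> suminf p * suminf p'"
    using assms by (intro tendsto_mult summable_LIMSEQ)
  ultimately show ?thesis
    by (simp add: sums_def)
qed

text \<open>
  Modulo multiples of \<open>p\<close> and \<open>p'\<close>, the increments in a window of three indices do not depend on the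
  terms before the window. The partial sums of the terms before its middle index are the most
  symmetric choice of these multiples.
\<close>

lemma product_increment_centered:
  fixes p p' :: "nat \<Rightarrow> real"
  defines "s \<equiv> \<lambda>n. \<Sum>i<Suc n. p i" and "s' \<equiv> \<lambda>n. \<Sum>i<Suc n. p' i"
  shows "product_increment p p' n = s' n * p n + s n * p' n - p n * p' n"
    "product_increment p p' (n + 1) =
       s' n * p (n + 1) + s n * p' (n + 1) + p (n + 1) * p' (n + 1)"
    "product_increment p p' (n + 2) =
       s' n * p (n + 2) + s n * p' (n + 2) +
       (p (n + 1) * p' (n + 2) + p (n + 2) * p' (n + 1) + p (n + 2) * p' (n + 2))"
  by (simp_all add: product_increment_def s_def s'_def algebra_simps)

text \<open>
  Substituting the centered form into a linear expression in \<open>p\<close>, \<open>p'\<close> and the increments changes the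
  coefficients by an invertible triangular substitution \<open>(x, y, z) \<mapsto> (X, Y, z)\<close>.
\<close>

lemma relation_centered:
  fixes p p' :: "nat \<Rightarrow> real"
  obtains X Y where
    "x = X - z * (\<Sum>i<Suc n. p' i)" "y = Y - z * (\<Sum>i<Suc n. p i)"
    "x * p n + y * p' n + z * product_increment p p' n =
       X * p n + Y * p' n - z * (p n * p' n)"
    "x * p (n + 1) + y * p' (n + 1) + z * product_increment p p' (n + 1) =
       X * p (n + 1) + Y * p' (n + 1) + z * (p (n + 1) * p' (n + 1))"
    "x * p (n + 2) + y * p' (n + 2) + z * product_increment p p' (n + 2) =
       X * p (n + 2) + Y * p' (n + 2) +
       z * (p (n + 1) * p' (n + 2) + p (n + 2) * p' (n + 1) + p (n + 2) * p' (n + 2))"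
proof
  define s s' where "s = (\<Sum>i<Suc n. p i)" and "s' = (\<Sum>i<Suc n. p' i)"
  show "x = (x + z * s') - z * s'" "y = (y + z * s) - z * s"
    by simp_all
  show "x * p n + y * p' n + z * product_increment p p' n =
      (x + z * s') * p n + (y + z * s) * p' n - z * (p n * p' n)"
    unfolding product_increment_centered(1)[of p p' n] s_def[symmetric] s'_def[symmetric]
    by (simp add: algebra_simps)
  show "x * p (n + 1) + y * p' (n + 1) + z * product_increment p p' (n + 1) =
      (x + z * s') * p (n + 1) + (y + z * s) * p' (n + 1) + z * (p (n + 1) * p' (n + 1))"
    unfolding product_increment_centered(2)[of p p' n] s_def[symmetric] s'_def[symmetric]
    by (simp add: algebra_simps)
  show "x * p (n + 2) + y * p' (n + 2) + z * product_increment p p' (n + 2) =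
      (x + z * s') * p (n + 2) + (y + z * s) * p' (n + 2) +
       z * (p (n + 1) * p' (n + 2) + p (n + 2) * p' (n + 1) + p (n + 2) * p' (n + 2))"
    unfolding product_increment_centered(3)[of p p' n] s_def[symmetric] s'_def[symmetric]
    by (simp add: algebra_simps)
qed

text \<open>
  Cramer's rule for the three rows of a centered window, the first two of which vanish on
  \<open>(X, Y, Z)\<close>: \<open>D\<close> is minus the determinant, and the factors of \<open>e2\<close> are, up to sign, the components
  of the cross product of the first two rows. The first two components have no zeros for positive
  entries.
\<close>

lemma Delta_determinant:
  fixes X Y Z p0 p1 p2 q0 q1 q2 :: real
  assumes e0: "X * p0 + Y * q0 - Z * (p0 * q0) = 0"
    and e1: "X * p1 + Y * q1 + Z * (p1 * q1) = 0"
  defines "D \<equiv> (p0 + p1 + p2) * q0 * q2 * p1 - (q0 + q1 + q2) * p0 * p2 * q1"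
    and "e2 \<equiv> X * p2 + Y * q2 + Z * (p1 * q2 + p2 * q1 + p2 * q2)"
  shows "X * D + e2 * (q0 * q1 * (p0 + p1)) = 0"
    and "Y * D - e2 * (p0 * p1 * (q0 + q1)) = 0"
    and "Z * D + e2 * (p0 * q1 - q0 * p1) = 0"
  using e0 e1 unfolding D_def e2_def by algebra+

lemma relation_trivial_if_Delta_nonzero:
  fixes p p' :: "nat \<Rightarrow> real"
  assumes rel: "\<And>i. x * p i + y * p' i + z * product_increment p p' i = 0"
    and "Delta p p' n \<noteq> 0"
  shows "x = 0 \<and> y = 0 \<and> z = 0"
proof -
  obtain X Y where XY: "x = X - z * (\<Sum>i<Suc n. p' i)" "y = Y - z * (\<Sum>i<Suc n. p i)"
    and e: "X * p n + Y * p' n - z * (p n * p' n) = 0"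
      "X * p (n + 1) + Y * p' (n + 1) + z * (p (n + 1) * p' (n + 1)) = 0"
      "X * p (n + 2) + Y * p' (n + 2) +
       z * (p (n + 1) * p' (n + 2) + p (n + 2) * p' (n + 1) + p (n + 2) * p' (n + 2)) = 0"
    using relation_centered[of x z p' n y p] unfolding rel by metis
  have "X = 0" "Y = 0" "z = 0"
    using Delta_determinant[OF e(1,2), of "p (n + 2)" "p' (n + 2)"] assms(2)
    unfolding Delta_def e(3) by simp_all
  then show ?thesis using XY by simp
qed

text \<open>
  The first two rows \<open>(p n, p' n, product_increment p p' n)\<close> determine the relation up to a factor, as
  their cross product \<open>(x, - y, - z)\<close>; that \<open>x\<close> and \<open>y\<close> are positive can be read off there. By
  induction it holds for all rows: if it holds for two consecutive rows and \<open>Delta\<close> vanishes, it holds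
  for the next one.
\<close>

lemma relation_if_Delta_zero:
  fixes p p' :: "nat \<Rightarrow> real"
  assumes pos: "\<And>i. p i > 0" "\<And>i. p' i > 0"
    and Delta: "\<And>i. Delta p p' i = 0"
  obtains x y z where "x > 0" "y > 0"
    "x *\<^sub>R p - y *\<^sub>R p' = z *\<^sub>R product_increment p p'"
proof -
  let ?q = "product_increment p p'"
  define x where "x = p' 0 * p 1 * (p' 0 + p' 1)"
  define y where "y = p 0 * p' 1 * (p 0 + p 1)"
  define z where "z = p' 0 * p 1 - p 0 * p' 1"
  have q01: "?q 0 = p 0 * p' 0" "?q 1 = p 1 * p' 0 + p 0 * p' 1 + p 1 * p' 1"
    by (simp_all add: product_increment_def algebra_simps)
  have rel: "x * p n + (- y) * p' n + (- z) * ?q n = 0 \<and>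
      x * p (n + 1) + (- y) * p' (n + 1) + (- z) * ?q (n + 1) = 0" for n
  proof (induction n)
    case 0
    show ?case
      unfolding add_0 q01 x_def y_def z_def by (simp add: algebra_simps)
  next
    case (Suc n)
    obtain X Y where e: "X * p n + Y * p' n - (- z) * (p n * p' n) = 0"
      "X * p (n + 1) + Y * p' (n + 1) + (- z) * (p (n + 1) * p' (n + 1)) = 0"
      and e2: "x * p (n + 2) + (- y) * p' (n + 2) + (- z) * ?q (n + 2) =
        X * p (n + 2) + Y * p' (n + 2) +
       (- z) * (p (n + 1) * p' (n + 2) + p (n + 2) * p' (n + 1) + p (n + 2) * p' (n + 2))"
      using relation_centered[of x "- z" p' n "- y" p] Suc by metis
    have "(x * p (n + 2) + (- y) * p' (n + 2) + (- z) * ?q (n + 2)) *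
        (p' n * p' (n + 1) * (p n + p (n + 1))) = 0"
      using Delta_determinant(1)[OF e, of "p (n + 2)" "p' (n + 2)"] Delta[of n]
      unfolding e2 Delta_def by simp
    moreover have "p' n * p' (n + 1) * (p n + p (n + 1)) > 0"
      using pos by (intro mult_pos_pos add_pos_pos)
    ultimately have "x * p (n + 2) + (- y) * p' (n + 2) + (- z) * ?q (n + 2) = 0"
      by (metis mult_eq_0_iff less_irrefl)
    then show ?case
      using Suc by simp
  qed
  show ?thesis
  proof
    show "x > 0" "y > 0"
      unfolding x_def y_def using pos by (intro mult_pos_pos add_pos_pos; blast)+
    show "x *\<^sub>R p - y *\<^sub>R p' = z *\<^sub>R ?q"
      using rel by (simp add: fun_eq_iff)
  qed
qed

text \<open>
  The ratio \<open>product_increment p p' n / p n\<close> is larger at 1 than at 0.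
\<close>

lemma product_increment_not_multiple:
  fixes p p' :: "nat \<Rightarrow> real"
  assumes pos: "\<And>i. p i > 0" "\<And>i. p' i > 0"
    and rel: "a *\<^sub>R p + b *\<^sub>R product_increment p p' = 0"
  shows "a = 0 \<and> b = 0"
proof -
  let ?q = "product_increment p p'"
  have q01: "?q 0 = p 0 * p' 0" "?q 1 = p 1 * p' 0 + (p 0 + p 1) * p' 1"
    by (simp_all add: product_increment_def algebra_simps)
  have eq: "a * p n + b * ?q n = 0" for n
    using fun_cong[OF rel, of n] by simp
  have "p 0 * (a + b * p' 0) = 0"
    using eq[of 0] unfolding q01 by (simp add: algebra_simps)
  then have a: "a = - b * p' 0"
    using pos(1)[of 0] by simp
  then have "b * ((p 0 + p 1) * p' 1) = 0"
    using eq[of 1] unfolding q01 by (simp add: algebra_simps)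
  moreover have "(p 0 + p 1) * p' 1 > 0"
    using pos by (intro mult_pos_pos add_pos_pos)
  ultimately have "b = 0"
    by (metis mult_eq_0_iff less_irrefl)
  then show ?thesis using a by simp
qed

section \<open>Cones spanned by three vectors\<close>

text \<open>
  For \<open>c > 0\<close> the inequalities say that \<open>a\<close> and \<open>b\<close> are positive, for \<open>c < 0\<close> that \<open>a + S' * c\<close> and
  \<open>b + S * c\<close> are; together with \<open>- c\<close> these are the coordinates with respect to \<open>p\<close>, \<open>p'\<close> and the
  reflected third edge.
\<close>

lemma split_by_sign:
  fixes p p' q :: "'a::real_vector" and S S' :: real
  assumes "S > 0" "S' > 0"
  shows "{a *\<^sub>R p + b *\<^sub>R p' + c *\<^sub>R q | a b c.
      a > 0 \<and> b > 0 \<and> a + S' * c > 0 \<and> b + S * c > 0 \<and> (c = 0 \<longrightarrow> a = b)} =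
    open_trihedral p p' q \<union> open_trihedral p p' (S' *\<^sub>R p + S *\<^sub>R p' - q) \<union> open_ray (p + p')"
    (is "?A = ?T \<union> ?T' \<union> ?R")
proof (intro equalityI subsetI)
  fix x assume "x \<in> ?A"
  then obtain a b c where abc: "a > 0" "b > 0" "a + S' * c > 0" "b + S * c > 0" "c = 0 \<longrightarrow> a = b"
    and x: "x = a *\<^sub>R p + b *\<^sub>R p' + c *\<^sub>R q" by blast
  consider "c > 0" | "c = 0" | "c < 0" by linarith
  then show "x \<in> ?T \<union> ?T' \<union> ?R"
  proof cases
    case 1
    then show ?thesis using abc x unfolding open_trihedral_def by blast
  next
    case 2
    then have "x = a *\<^sub>R (p + p')"
      using abc x by (simp add: algebra_simps)
    then show ?thesis using abc unfolding open_ray_def by blast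
  next
    case 3
    have "x = (a + S' * c) *\<^sub>R p + (b + S * c) *\<^sub>R p' + (- c) *\<^sub>R (S' *\<^sub>R p + S *\<^sub>R p' - q)"
      by (simp add: x algebra_simps)
    moreover have "- c > 0" using 3 by simp
    ultimately show ?thesis using abc unfolding open_trihedral_def by blast
  qed
next
  fix x assume "x \<in> ?T \<union> ?T' \<union> ?R"
  then consider "x \<in> ?T" | "x \<in> ?T'" | "x \<in> ?R" by blast
  then show "x \<in> ?A"
  proof cases
    case 1
    then obtain a b c where "a > 0" "b > 0" "c > 0" "x = a *\<^sub>R p + b *\<^sub>R p' + c *\<^sub>R q"
      unfolding open_trihedral_def by blast
    moreover from this have "a + S' * c > 0" "b + S * c > 0"
      using assms by (simp_all add: add_pos_pos)
    ultimately show ?thesis by force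
  next
    case 2
    then obtain a b c where abc: "a > 0" "b > 0" "c > 0"
      "x = a *\<^sub>R p + b *\<^sub>R p' + c *\<^sub>R (S' *\<^sub>R p + S *\<^sub>R p' - q)"
      unfolding open_trihedral_def by blast
    then have "x = (a + S' * c) *\<^sub>R p + (b + S * c) *\<^sub>R p' + (- c) *\<^sub>R q"
      by (simp add: algebra_simps)
    moreover have "a + S' * c > 0" "b + S * c > 0"
      using assms abc by (simp_all add: add_pos_pos)
    moreover have "(a + S' * c) + S' * (- c) > 0" "(b + S * c) + S * (- c) > 0" "- c \<noteq> 0"
      using abc by simp_all
    ultimately show ?thesis by blast
  next
    case 3
    then obtain t where "t > 0" "x = t *\<^sub>R p + t *\<^sub>R p' + 0 *\<^sub>R q"
      unfolding open_ray_def by (auto simp: algebra_simps)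
    then show ?thesis by force
  qed
qed

text \<open>
  The relation together with \<open>q + w = S' *\<^sub>R p + S *\<^sub>R p'\<close> is a linear system for \<open>p\<close> and \<open>p'\<close>.
\<close>

lemma flat_edge_combinations:
  fixes p p' q :: "'a::real_vector" and S S' \<theta> :: real
  assumes rel: "(\<theta> * S') *\<^sub>R p - ((1 - \<theta>) * S) *\<^sub>R p' = (2 * \<theta> - 1) *\<^sub>R q"
  defines "w \<equiv> S' *\<^sub>R p + S *\<^sub>R p' - q"
  shows "S' *\<^sub>R p = \<theta> *\<^sub>R q + (1 - \<theta>) *\<^sub>R w" and "S *\<^sub>R p' = (1 - \<theta>) *\<^sub>R q + \<theta> *\<^sub>R w"
proof -
  have qw: "q + w = S' *\<^sub>R p + S *\<^sub>R p'"
    by (simp add: w_def)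
  have "S' *\<^sub>R p = ((\<theta> * S') *\<^sub>R p - ((1 - \<theta>) * S) *\<^sub>R p') + (1 - \<theta>) *\<^sub>R (q + w)"
    unfolding qw by (simp add: algebra_simps)
  also have "\<dots> = ((2 * \<theta> - 1) + (1 - \<theta>)) *\<^sub>R q + (1 - \<theta>) *\<^sub>R w"
    unfolding rel by (simp only: scaleR_add_left scaleR_add_right add.assoc)
  finally show Sp: "S' *\<^sub>R p = \<theta> *\<^sub>R q + (1 - \<theta>) *\<^sub>R w"
    by simp
  have "S *\<^sub>R p' = (q + w) - S' *\<^sub>R p"
    unfolding qw by simp
  then show "S *\<^sub>R p' = (1 - \<theta>) *\<^sub>R q + \<theta> *\<^sub>R w"
    unfolding Sp by (simp add: algebra_simps)
qed

text \<open>
  By the previous lemma \<open>p\<close> and \<open>p'\<close> lie inside the angle between \<open>q\<close> and \<open>w\<close>, hence so do all three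
  pieces. Conversely, \<open>q + w\<close> is a positive combination of \<open>p\<close> and \<open>p'\<close>. It bisects the angle in
  the coordinates \<open>q\<close>, \<open>w\<close>, one trihedral angle covers the side towards \<open>q\<close> and the other one the side
  towards \<open>w\<close>. The bisector itself needs a separate argument, since the trihedral angles contain
  only combinations in which \<open>q\<close> or \<open>w\<close> really occurs: for \<open>\<theta> \<noteq> 1 / 2\<close> the relation
  is used to make \<open>q\<close> appear, and for \<open>\<theta> = 1 / 2\<close> the vectors \<open>p\<close> and \<open>p'\<close> are proportional and the
  bisector is the ray of \<open>p + p'\<close>.
\<close>

lemma flat_union_eq_angle:
  fixes p p' q :: "'a::real_vector" and S S' \<theta> :: real
  assumes S: "S > 0" "S' > 0" and \<theta>: "0 < \<theta>" "\<theta> < 1"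
    and rel: "(\<theta> * S') *\<^sub>R p - ((1 - \<theta>) * S) *\<^sub>R p' = (2 * \<theta> - 1) *\<^sub>R q"
  defines "w \<equiv> S' *\<^sub>R p + S *\<^sub>R p' - q"
  shows "open_trihedral p p' q \<union> open_trihedral p p' w \<union> open_ray (p + p') = open_angle q w" (is "?U = _")
proof -
  have qw: "q + w = S' *\<^sub>R p + S *\<^sub>R p'"
    by (simp add: w_def)
  note Sp = flat_edge_combinations(1)[OF rel, folded w_def]
    and Sp' = flat_edge_combinations(2)[OF rel, folded w_def]
  have p: "p = (\<theta> / S') *\<^sub>R q + ((1 - \<theta>) / S') *\<^sub>R w"
    using arg_cong[OF Sp, of "\<lambda>x. (1 / S') *\<^sub>R x"] S by (simp add: scaleR_add_right)
  have p': "p' = ((1 - \<theta>) / S) *\<^sub>R q + (\<theta> / S) *\<^sub>R w"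
    using arg_cong[OF Sp', of "\<lambda>x. (1 / S) *\<^sub>R x"] S by (simp add: scaleR_add_right)
  have angle: "a *\<^sub>R p + b *\<^sub>R p' + c *\<^sub>R q + d *\<^sub>R w \<in> open_angle q w"
    if "a > 0" "b > 0" "c \<ge> 0" "d \<ge> 0" for a b c d
  proof -
    have "a *\<^sub>R p + b *\<^sub>R p' + c *\<^sub>R q + d *\<^sub>R w =
      (a * (\<theta> / S') + b * ((1 - \<theta>) / S) + c) *\<^sub>R q + (a * ((1 - \<theta>) / S') + b * (\<theta> / S) + d) *\<^sub>R w"
      by (subst p, subst p') (simp add: algebra_simps del: times_divide_eq_right)
    moreover have "a * (\<theta> / S') + b * ((1 - \<theta>) / S) + c > 0" "a * ((1 - \<theta>) / S') + b * (\<theta> / S) + d > 0"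
      using that S \<theta> by (simp_all add: add_pos_nonneg add_pos_pos)
    ultimately show ?thesis
      unfolding open_angle_def by blast
  qed
  show ?thesis
  proof (intro equalityI subsetI)
    fix x assume "x \<in> ?U"
    then consider "x \<in> open_trihedral p p' q" | "x \<in> open_trihedral p p' w" | "x \<in> open_ray (p + p')"
      by blast
    then show "x \<in> open_angle q w"
    proof cases
      case 1
      then show ?thesis
        using angle[of _ _ _ 0] unfolding open_trihedral_def by force
    next
      case 2
      then show ?thesis
        using angle[of _ _ 0] unfolding open_trihedral_def by force
    next
      case 3
      then show ?thesis
        using angle[of _ _ 0 0] unfolding open_ray_def by (force simp: scaleR_add_right)
    qed
  next
    fix x assume "x \<in> open_angle q w"
    then obtain f g where fg: "f > 0" "g > 0" and x: "x = f *\<^sub>R q + g *\<^sub>R w"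
      unfolding open_angle_def by blast
    consider "f > g" | "f < g" | "f = g" "\<theta> < 1 / 2" | "f = g" "\<theta> > 1 / 2" | "f = g" "\<theta> = 1 / 2"
      by linarith
    then show "x \<in> ?U"
    proof cases
      case 1
      have "x = g *\<^sub>R (q + w) + (f - g) *\<^sub>R q"
        by (simp add: x algebra_simps)
      also have "\<dots> = (g * S') *\<^sub>R p + (g * S) *\<^sub>R p' + (f - g) *\<^sub>R q"
        unfolding qw by (simp add: algebra_simps)
      finally show ?thesis
        using 1 fg S unfolding open_trihedral_def
        by (intro UnI1 CollectI exI[of _ "g * S'"] exI[of _ "g * S"] exI[of _ "f - g"]) simp
    next
      case 2
      have "x = f *\<^sub>R (q + w) + (g - f) *\<^sub>R w"
        by (simp add: x algebra_simps)
      also have "\<dots> = (f * S') *\<^sub>R p + (f * S) *\<^sub>R p' + (g - f) *\<^sub>R w"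
        unfolding qw by (simp add: algebra_simps)
      finally show ?thesis
        using 2 fg S unfolding open_trihedral_def
        by (intro UnI1[OF UnI2] CollectI exI[of _ "f * S'"] exI[of _ "f * S"] exI[of _ "g - f"]) simp
    next
      case 3
      have "x = f *\<^sub>R (q + w) + f *\<^sub>R (((\<theta> * S') *\<^sub>R p - ((1 - \<theta>) * S) *\<^sub>R p') - (2 * \<theta> - 1) *\<^sub>R q)"
        unfolding rel by (simp add: x 3 scaleR_add_right)
      also have "\<dots> = (f * S' * (1 + \<theta>)) *\<^sub>R p + (f * S * \<theta>) *\<^sub>R p' + (f * (1 - 2 * \<theta>)) *\<^sub>R q"
        unfolding qw by (simp add: algebra_simps)
      finally show ?thesis
        using 3 fg S \<theta> unfolding open_trihedral_def
        by (intro UnI1 CollectI exI[of _ "f * S' * (1 + \<theta>)"] exI[of _ "f * S * \<theta>"]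
            exI[of _ "f * (1 - 2 * \<theta>)"]) simp
    next
      case 4
      have "x = f *\<^sub>R (q + w) - f *\<^sub>R (((\<theta> * S') *\<^sub>R p - ((1 - \<theta>) * S) *\<^sub>R p') - (2 * \<theta> - 1) *\<^sub>R q)"
        unfolding rel by (simp add: x 4 scaleR_add_right)
      also have "\<dots> = (f * S' * (1 - \<theta>)) *\<^sub>R p + (f * S * (2 - \<theta>)) *\<^sub>R p' + (f * (2 * \<theta> - 1)) *\<^sub>R q"
        unfolding qw
        by (simp add: algebra_simps) (metis mult_2_right distrib_left scaleR_add_left)
      finally show ?thesis
        using 4 fg S \<theta> unfolding open_trihedral_def
        by (intro UnI1 CollectI exI[of _ "f * S' * (1 - \<theta>)"] exI[of _ "f * S * (2 - \<theta>)"]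
            exI[of _ "f * (2 * \<theta> - 1)"]) simp
    next
      case 5
      have "1 - \<theta> = \<theta>"
        using 5 by simp
      then have eq: "S' *\<^sub>R p = S *\<^sub>R p'"
        unfolding Sp Sp' by (simp only:)
      have "p' = (1 / S) *\<^sub>R (S *\<^sub>R p')"
        using S by simp
      then have p'_p: "p' = (S' / S) *\<^sub>R p"
        unfolding eq[symmetric] by simp
      define t where "t = 2 * f * S' / (1 + S' / S)"
      have "1 + S' / S > 0"
        using S by (simp add: add_pos_pos)
      then have "t > 0" and t: "t * (1 + S' / S) = f * S' + f * S'"
        using fg S by (simp_all add: t_def)
      have "x = f *\<^sub>R (q + w)"
        by (simp add: x 5 scaleR_add_right)
      also have "\<dots> = (f * S' + f * S') *\<^sub>R p"
        unfolding qw eq[symmetric] by (simp only: scaleR_add_left scaleR_add_right scaleR_scaleR)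
      also have "\<dots> = t *\<^sub>R (p + p')"
        unfolding t[symmetric] by (subst p'_p) (simp add: algebra_simps)
      finally show ?thesis
        using \<open>t > 0\<close> unfolding open_ray_def by blast
    qed
  qed
qed

section \<open>Summability and linear independence\<close>

lemma subspace_ell1: "subspace ell1"
proof (rule subspaceI)
  show "0 \<in> ell1"
    by (simp add: ell1_def)
next
  fix x y assume "x \<in> ell1" "y \<in> ell1"
  then have "summable (\<lambda>i. \<bar>x i\<bar> + \<bar>y i\<bar>)"
    unfolding ell1_def by (auto intro: summable_add)
  then show "x + y \<in> ell1"
    unfolding ell1_def by (auto intro: summable_comparison_test' abs_triangle_ineq)
next
  fix c :: real and x assume "x \<in> ell1"
  then show "c *\<^sub>R x \<in> ell1"
    unfolding ell1_def by (auto simp: abs_mult intro: summable_mult)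
qed

lemma product_increment_in_ell1:
  assumes "summable p" "summable p'" and pos: "\<And>i. p i > 0" "\<And>i. p' i > 0"
  shows "product_increment p p' \<in> ell1"
proof -
  have "product_increment p p' n \<ge> 0" for n
    unfolding product_increment_def using pos
    by (simp add: sum_nonneg less_imp_le mult_mono)
  then show ?thesis
    using sums_summable[OF product_increment_sums[OF assms(1,2)]] by (simp add: ell1_def)
qed

lemma independent3I:
  fixes u v w :: "'a::real_vector"
  assumes triv: "\<And>x y z. x *\<^sub>R u + y *\<^sub>R v + z *\<^sub>R w = 0 \<Longrightarrow> x = 0 \<and> y = 0 \<and> z = 0"
  shows "distinct [u, v, w]" and "independent {u, v, w}"
proof -
  show dist: "distinct [u, v, w]"
    using triv[of 1 "-1" 0] triv[of 1 0 "-1"] triv[of 0 1 "-1"] by auto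
  show "independent {u, v, w}"
    using dist triv[of "_ u" "_ v" "_ w"] by (auto simp: dependent_finite add.assoc)
qed

lemma independent2I:
  fixes u v :: "'a::real_vector"
  assumes triv: "\<And>x y. x *\<^sub>R u + y *\<^sub>R v = 0 \<Longrightarrow> x = 0 \<and> y = 0"
  shows "u \<noteq> v" and "independent {u, v}"
proof -
  show dist: "u \<noteq> v"
    using triv[of 1 "-1"] by auto
  show "independent {u, v}"
    using dist triv[of "_ u" "_ v"] by (auto simp: dependent_finite)
qed

section \<open>The set of attainable sequences\<close>

theorem proposition5:
  fixes p p' :: "nat \<Rightarrow> real"
  assumes "p \<in> ell1" and "p' \<in> ell1"
    and "\<And>i. p i > 0" and "\<And>i. p' i > 0"
  shows
    "((\<exists>i. Delta p p' i \<noteq> 0) \<longrightarrow>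
       (\<exists>V u v w w' d.
          subspace V \<and> V \<subseteq> ell1 \<and> dim V = 3 \<and> {u, v, w, w'} \<subseteq> V \<and>
          distinct [u, v, w] \<and> independent {u, v, w} \<and>
          distinct [u, v, w'] \<and> independent {u, v, w'} \<and>
          open_trihedral u v w \<inter> open_trihedral u v w' = {} \<and>
          d \<noteq> 0 \<and> open_ray d \<subseteq> face u v \<and>
          open_ray d \<noteq> open_ray u \<and> open_ray d \<noteq> open_ray v \<and>
          attainable_set p p' =
            open_trihedral u v w \<union> open_trihedral u v w' \<union> open_ray d)) \<and>
     ((\<forall>i. Delta p p' i = 0) \<longrightarrow>
       (\<exists>u v. {u, v} \<subseteq> ell1 \<and> u \<noteq> v \<and> independent {u, v} \<and>
          attainable_set p p' = open_angle u v))"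
proof -
  have sm: "summable p" "summable p'"
    using assms(1,2) by (auto simp: ell1_def intro: summable_rabs_cancel)
  define S S' q w where "S = suminf p" and "S' = suminf p'" and "q = product_increment p p'"
    and "w = S' *\<^sub>R p + S *\<^sub>R p' - q"
  have S: "S > 0" "S' > 0"
    unfolding S_def S'_def using sm assms(3,4) by (simp_all add: suminf_pos)
  have q: "q \<in> ell1"
    unfolding q_def using sm assms(3,4) by (rule product_increment_in_ell1)
  have w: "w \<in> ell1"
    unfolding w_def using assms(1,2) q
    by (intro subspace_diff subspace_add subspace_mul subspace_ell1)
  have att: "attainable_set p p' =
      open_trihedral p p' q \<union> open_trihedral p p' w \<union> open_ray (p + p')"
    unfolding w_def split_by_sign[OF S, symmetric]
    unfolding attainable_set_def area_attainable_iff[OF sm assms(3,4)] S_def S'_def q_def by blast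
  show ?thesis
  proof (intro conjI impI)
    assume "\<exists>i. Delta p p' i \<noteq> 0"
    then obtain n where n: "Delta p p' n \<noteq> 0" ..
    have triv: "x = 0 \<and> y = 0 \<and> z = 0" if "x *\<^sub>R p + y *\<^sub>R p' + z *\<^sub>R q = 0" for x y z
      using relation_trivial_if_Delta_nonzero[of x p y p' z n] n that
      unfolding q_def by (simp add: fun_eq_iff)
    have triv_w: "x = 0 \<and> y = 0 \<and> z = 0" if "x *\<^sub>R p + y *\<^sub>R p' + z *\<^sub>R w = 0" for x y z
    proof -
      have "(x + z * S') *\<^sub>R p + (y + z * S) *\<^sub>R p' + (- z) *\<^sub>R q = x *\<^sub>R p + y *\<^sub>R p' + z *\<^sub>R w"
        by (simp add: w_def algebra_simps)
      also have "\<dots> = 0"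
        by (rule that)
      finally show ?thesis
        using triv[of "x + z * S'" "y + z * S" "- z"] by auto
    qed
    let ?V = "span {p, p', q}"
    have indep: "distinct [p, p', q]" "independent {p, p', q}"
        "distinct [p, p', w]" "independent {p, p', w}"
      using independent3I[of p p' q] independent3I[of p p' w] triv triv_w by blast+
    have "dim ?V = 3"
      using dim_span_eq_card_independent[OF indep(2)] indep(1) by simp
    moreover have "?V \<subseteq> ell1"
      using assms(1,2) q by (intro span_minimal subspace_ell1) auto
    moreover have "{p, p', q, w} \<subseteq> ?V"
      unfolding w_def by (auto intro!: span_diff span_add span_scale intro: span_base)
    moreover have "open_trihedral p p' q \<inter> open_trihedral p p' w = {}"
    proof (rule ccontr)
      assume "open_trihedral p p' q \<inter> open_trihedral p p' w \<noteq> {}"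
      then obtain a b c a' b' c' where c: "c > 0" "c' > 0"
        and eq: "a *\<^sub>R p + b *\<^sub>R p' + c *\<^sub>R q = a' *\<^sub>R p + b' *\<^sub>R p' + c' *\<^sub>R w"
        unfolding open_trihedral_def by blast
      have "(a - a' - c' * S') *\<^sub>R p + (b - b' - c' * S) *\<^sub>R p' + (c + c') *\<^sub>R q =
        (a *\<^sub>R p + b *\<^sub>R p' + c *\<^sub>R q) - (a' *\<^sub>R p + b' *\<^sub>R p' + c' *\<^sub>R w)"
        by (simp add: w_def algebra_simps)
      then have "c + c' = 0"
        using triv unfolding eq by simp
      then show False using c by simp
    qed
    moreover have "p + p' \<noteq> 0"
      using triv[of 1 1 0] by auto
    moreover have "open_ray (p + p') \<subseteq> face p p'"
      unfolding open_ray_def face_def by (force simp: scaleR_add_right)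
    moreover have "open_ray (p + p') \<noteq> open_ray p" "open_ray (p + p') \<noteq> open_ray p'"
    proof -
      have "p + p' \<in> open_ray (p + p')"
        unfolding open_ray_def by (auto intro: exI[of _ 1])
      moreover have "p + p' \<notin> open_ray p"
      proof
        assume "p + p' \<in> open_ray p"
        then obtain t where "p + p' = t *\<^sub>R p" unfolding open_ray_def by blast
        then show False using triv[of "1 - t" 1 0] by (simp add: algebra_simps)
      qed
      moreover have "p + p' \<notin> open_ray p'"
      proof
        assume "p + p' \<in> open_ray p'"
        then obtain t where "p + p' = t *\<^sub>R p'" unfolding open_ray_def by blast
        then show False using triv[of 1 "1 - t" 0] by (simp add: algebra_simps)
      qed
      ultimately show "open_ray (p + p') \<noteq> open_ray p" "open_ray (p + p') \<noteq> open_ray p'"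
        by blast+
    qed
    ultimately show "\<exists>V u v w w' d.
          subspace V \<and> V \<subseteq> ell1 \<and> dim V = 3 \<and> {u, v, w, w'} \<subseteq> V \<and>
          distinct [u, v, w] \<and> independent {u, v, w} \<and>
          distinct [u, v, w'] \<and> independent {u, v, w'} \<and>
          open_trihedral u v w \<inter> open_trihedral u v w' = {} \<and>
          d \<noteq> 0 \<and> open_ray d \<subseteq> face u v \<and>
          open_ray d \<noteq> open_ray u \<and> open_ray d \<noteq> open_ray v \<and>
          attainable_set p p' =
            open_trihedral u v w \<union> open_trihedral u v w' \<union> open_ray d"
      using att indep subspace_span[of "{p, p', q}"]
      by - (rule exI[of _ ?V], rule exI[of _ p], rule exI[of _ p'], rule exI[of _ q],
          rule exI[of _ w], rule exI[of _ "p + p'"], intro conjI)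
  next
    assume "\<forall>i. Delta p p' i = 0"
    then obtain x y z where xy: "x > 0" "y > 0" and rel: "x *\<^sub>R p - y *\<^sub>R p' = z *\<^sub>R q"
      using relation_if_Delta_zero[of p p'] assms(3,4) unfolding q_def by metis
    \<comment> \<open>summing the relation over all indices\<close>
    have "(\<lambda>n. x * p n - y * p' n) sums (x * S - y * S')"
      unfolding S_def S'_def using sm by (intro sums_diff sums_mult summable_sums)
    moreover have "(\<lambda>n. z * q n) sums (z * (S * S'))"
      unfolding q_def S_def S'_def using sm by (intro sums_mult product_increment_sums)
    moreover have "(\<lambda>n. x * p n - y * p' n) = (\<lambda>n. z * q n)"
      using rel by (simp add: fun_eq_iff)
    ultimately have z: "x * S - y * S' = z * (S * S')"
      using sums_unique2 by metis
    \<comment> \<open>scaled by \<open>c\<close>, the relation takes the normal form of the cone lemma, because the last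
      coefficient is determined by the sums of the series\<close>
    define \<theta> where "\<theta> = x * S / (x * S + y * S')"
    define c where "c = S * S' / (x * S + y * S')"
    have den: "x * S + y * S' > 0"
      using xy S by (simp add: add_pos_pos)
    have \<theta>: "0 < \<theta>" "\<theta> < 1"
      using xy S den by (simp_all add: \<theta>_def field_simps)
    have coeffs: "\<theta> * S' = c * x" "(1 - \<theta>) * S = c * y" "2 * \<theta> - 1 = c * z"
      using den z by (simp_all add: \<theta>_def c_def field_simps)
    have "(\<theta> * S') *\<^sub>R p - ((1 - \<theta>) * S) *\<^sub>R p' = c *\<^sub>R (x *\<^sub>R p - y *\<^sub>R p')"
      unfolding coeffs by (simp add: algebra_simps)
    also have "\<dots> = (2 * \<theta> - 1) *\<^sub>R q"
      unfolding rel coeffs by simp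
    finally have \<theta>_rel: "(\<theta> * S') *\<^sub>R p - ((1 - \<theta>) * S) *\<^sub>R p' = (2 * \<theta> - 1) *\<^sub>R q" .
    have triv: "a = 0 \<and> b = 0" if ab: "a *\<^sub>R q + b *\<^sub>R w = 0" for a b
    proof -
      note Sp = flat_edge_combinations(1)[OF \<theta>_rel, folded w_def]
      have "(1 - \<theta>) *\<^sub>R (a *\<^sub>R q + b *\<^sub>R w) =
          (a * (1 - \<theta>) - b * \<theta>) *\<^sub>R q + b *\<^sub>R (\<theta> *\<^sub>R q + (1 - \<theta>) *\<^sub>R w)"
        by (simp add: algebra_simps)
      then have "(b * S') *\<^sub>R p + (a * (1 - \<theta>) - b * \<theta>) *\<^sub>R q = 0"
        unfolding Sp[symmetric] ab by (simp add: add.commute)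
      then have "b * S' = 0 \<and> a * (1 - \<theta>) - b * \<theta> = 0"
        unfolding q_def by (rule product_increment_not_multiple[OF assms(3,4)])
      then show ?thesis
        using S \<theta> by auto
    qed
    show "\<exists>u v. {u, v} \<subseteq> ell1 \<and> u \<noteq> v \<and> independent {u, v} \<and> attainable_set p p' = open_angle u v"
      unfolding att flat_union_eq_angle[OF S \<theta> \<theta>_rel, folded w_def]
      using q w independent2I[of q w] triv by blast
  qed
qed

end
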